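(* There are infinitely many finite transitive permutation groups $G\leqslant\mathrm{Sym}(\Omega)$ which admit a product decomposition and satisfy $\rho(G,\Omega)>\sqrt{|\Omega|}$.
   Context: Let $G\leqslant\mathrm{Sym}(\Omega)$ be a finite transitive permutation group. Elements $x,y\in G$ intersect if some $\alpha\in\Omega$ satisfies $\alpha^{xy^{-1}}=\alpha$; a subset $S\subseteq G$ is an intersecting set if every two elements of $S$ intersect; it is maximum if it has the largest possible size among intersecting sets. $\rho(G,\Omega)$ denotes $|S|/|G_\omega|$ where $S$ is a maximum intersecting set and $G_\omega$ is a point stabilizer. A permutation group $G\leqslant\mathrm{Sym}(\Omega)$ admits a product decomposition if there are permutation groups $H\leqslant\mathrm{Sym}(\Delta)$ and $K\leqslant\mathrm{Sym}(\Theta)$ with $|\Delta|\ge 2$, $|\Theta|\geq 2$, such that $G$ is permutation equivalent to the wreath product $H\wr K$ in its product action on $\Delta^{\Theta}$. *)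

theory Defs
  imports "HOL-Algebra.Group_Action" Complex_Main
begin

text \<open>
  A permutation group on \<open>\<Omega>\<close> is a subgroup \<open>G\<close> of \<^term>\<open>BijGroup \<Omega>\<close>, acting on \<open>\<Omega>\<close> through
  \<^term>\<open>id\<close>. Permutations act on the left, so a product \<open>xy\<close> of right actions (first \<open>x\<close>,
  then \<open>y\<close>) is \<^term>\<open>y \<otimes>\<^bsub>BijGroup \<Omega>\<^esub> x\<close> here.
\<close>

abbreviation perm_group :: "'a set \<Rightarrow> ('a \<Rightarrow> 'a) set \<Rightarrow> ('a \<Rightarrow> 'a) monoid" where
  "perm_group \<Omega> G \<equiv> BijGroup \<Omega>\<lparr>carrier := G\<rparr>"

definition finite_transitive_group :: "'a set \<Rightarrow> ('a \<Rightarrow> 'a) set \<Rightarrow> bool" where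
  "finite_transitive_group \<Omega> G \<longleftrightarrow>
     finite \<Omega> \<and> \<Omega> \<noteq> {} \<and> subgroup G (BijGroup \<Omega>) \<and> transitive_action (perm_group \<Omega> G) \<Omega> id"

subsection \<open>Intersecting sets\<close>

definition intersect :: "'a set \<Rightarrow> ('a \<Rightarrow> 'a) \<Rightarrow> ('a \<Rightarrow> 'a) \<Rightarrow> bool" where
  "intersect \<Omega> x y \<longleftrightarrow>
     (\<exists>\<alpha>\<in>\<Omega>. (inv\<^bsub>BijGroup \<Omega>\<^esub> y \<otimes>\<^bsub>BijGroup \<Omega>\<^esub> x) \<alpha> = \<alpha>)"

definition intersecting_set :: "'a set \<Rightarrow> ('a \<Rightarrow> 'a) set \<Rightarrow> ('a \<Rightarrow> 'a) set \<Rightarrow> bool" where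
  "intersecting_set \<Omega> G S \<longleftrightarrow> S \<subseteq> G \<and> (\<forall>x\<in>S. \<forall>y\<in>S. intersect \<Omega> x y)"

definition maximum_intersecting_set :: "'a set \<Rightarrow> ('a \<Rightarrow> 'a) set \<Rightarrow> ('a \<Rightarrow> 'a) set \<Rightarrow> bool" where
  "maximum_intersecting_set \<Omega> G S \<longleftrightarrow>
     intersecting_set \<Omega> G S \<and> (\<forall>T. intersecting_set \<Omega> G T \<longrightarrow> card T \<le> card S)"

text \<open>
  For a finite transitive group a maximum intersecting set exists and the value does not depend
  on the two choices; see \<open>rho_eq\<close> and \<open>ex_maximum_intersecting_set\<close> below.
\<close>

definition rho :: "('a \<Rightarrow> 'a) set \<Rightarrow> 'a set \<Rightarrow> real" where
  "rho G \<Omega> =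
     real (card (SOME S. maximum_intersecting_set \<Omega> G S)) /
     real (card (stabilizer (perm_group \<Omega> G) id (SOME \<omega>. \<omega> \<in> \<Omega>)))"

subsection \<open>Permutation equivalence\<close>

definition perm_equivalent ::
  "('g, 'm) monoid_scheme \<Rightarrow> 'a set \<Rightarrow> ('g \<Rightarrow> 'a \<Rightarrow> 'a) \<Rightarrow>
   ('h, 'n) monoid_scheme \<Rightarrow> 'b set \<Rightarrow> ('h \<Rightarrow> 'b \<Rightarrow> 'b) \<Rightarrow> bool" where
  "perm_equivalent G A \<phi> H B \<psi> \<longleftrightarrow>
     (\<exists>f \<eta>. bij_betw f A B \<and> \<eta> \<in> iso G H \<and>
        (\<forall>g\<in>carrier G. \<forall>a\<in>A. f (\<phi> g a) = \<psi> (\<eta> g) (f a)))"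

definition perm_equiv_rel :: "(('a set \<times> ('a \<Rightarrow> 'a) set) \<times> ('a set \<times> ('a \<Rightarrow> 'a) set)) set" where
  "perm_equiv_rel =
     {((\<Omega>, G), (\<Omega>', G')).
        subgroup G (BijGroup \<Omega>) \<and> subgroup G' (BijGroup \<Omega>') \<and>
        perm_equivalent (perm_group \<Omega> G) \<Omega> id (perm_group \<Omega>' G') \<Omega>' id}"

subsection \<open>Wreath products in product action\<close>

text \<open>
  The group \<open>H wr K\<close> is the semidirect product of the base group of functions from \<open>\<Theta>\<close> to \<open>H\<close>
  by \<open>K\<close>, where \<open>K\<close> permutes the coordinates.
\<close>

definition wreath_product ::
  "'d set \<Rightarrow> ('d \<Rightarrow> 'd) set \<Rightarrow> 't set \<Rightarrow> ('t \<Rightarrow> 't) set \<Rightarrow> (('t \<Rightarrow> 'd \<Rightarrow> 'd) \<times> ('t \<Rightarrow> 't)) monoid"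
  where
  "wreath_product \<Delta> H \<Theta> K =
     \<lparr>carrier = (\<Theta> \<rightarrow>\<^sub>E H) \<times> K,
      mult = (\<lambda>(h, k) (h', k').
        (\<lambda>\<theta>\<in>\<Theta>. h \<theta> \<otimes>\<^bsub>BijGroup \<Delta>\<^esub> h' ((inv\<^bsub>BijGroup \<Theta>\<^esub> k) \<theta>), k \<otimes>\<^bsub>BijGroup \<Theta>\<^esub> k')),
      one = (\<lambda>\<theta>\<in>\<Theta>. \<one>\<^bsub>BijGroup \<Delta>\<^esub>, \<one>\<^bsub>BijGroup \<Theta>\<^esub>)\<rparr>"

definition product_action ::
  "'d set \<Rightarrow> 't set \<Rightarrow> ('t \<Rightarrow> 'd \<Rightarrow> 'd) \<times> ('t \<Rightarrow> 't) \<Rightarrow> ('t \<Rightarrow> 'd) \<Rightarrow> ('t \<Rightarrow> 'd)" where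
  "product_action \<Delta> \<Theta> = (\<lambda>(h, k). \<lambda>f\<in>\<Theta> \<rightarrow>\<^sub>E \<Delta>. \<lambda>\<theta>\<in>\<Theta>. h \<theta> (f ((inv\<^bsub>BijGroup \<Theta>\<^esub> k) \<theta>)))"

text \<open>
  For finite \<open>\<Omega>\<close>, the sets \<open>\<Delta>\<close> and \<open>\<Theta>\<close> are necessarily finite, so there is no loss of generality
  in taking them to be sets of natural numbers. Note that \<^term>\<open>2 \<le> card \<Delta>\<close> includes finiteness.
\<close>

definition admits_product_decomposition :: "'a set \<Rightarrow> ('a \<Rightarrow> 'a) set \<Rightarrow> bool" where
  "admits_product_decomposition \<Omega> G \<longleftrightarrow>
     (\<exists>(\<Delta> :: nat set) H (\<Theta> :: nat set) K.
        2 \<le> card \<Delta> \<and> 2 \<le> card \<Theta> \<and>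
        subgroup H (BijGroup \<Delta>) \<and> subgroup K (BijGroup \<Theta>) \<and>
        perm_equivalent (perm_group \<Omega> G) \<Omega> id
          (wreath_product \<Delta> H \<Theta> K) (\<Theta> \<rightarrow>\<^sub>E \<Delta>) (product_action \<Delta> \<Theta>))"

subsection \<open>Well-definedness\<close>

lemma subgroup_BijGroup_subset: "subgroup G (BijGroup \<Omega>) \<Longrightarrow> G \<subseteq> Bij \<Omega>"
  by (drule subgroup.subset) (simp add: BijGroup_def)

lemma BijGroup_mult_apply:
  "\<lbrakk>x \<in> Bij \<Omega>; y \<in> Bij \<Omega>; a \<in> \<Omega>\<rbrakk> \<Longrightarrow> (x \<otimes>\<^bsub>BijGroup \<Omega>\<^esub> y) a = x (y a)"
  by (simp add: BijGroup_def compose_def)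

lemma BijGroup_inv_Bij: "x \<in> Bij \<Omega> \<Longrightarrow> inv\<^bsub>BijGroup \<Omega>\<^esub> x \<in> Bij \<Omega>"
  by (simp add: inv_BijGroup restrict_inv_into_Bij)

lemma Bij_apply: "\<lbrakk>x \<in> Bij \<Omega>; a \<in> \<Omega>\<rbrakk> \<Longrightarrow> x a \<in> \<Omega>"
  using Bij_imp_funcset by blast

lemma finite_Bij: "finite \<Omega> \<Longrightarrow> finite (Bij \<Omega>)"
proof (rule finite_subset)
  show "Bij \<Omega> \<subseteq> \<Omega> \<rightarrow>\<^sub>E \<Omega>"
    using Bij_imp_funcset Bij_imp_extensional by (auto simp: PiE_def)
qed (simp add: finite_PiE)

lemma intersect_iff:
  assumes "x \<in> Bij \<Omega>" "y \<in> Bij \<Omega>"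
  shows "intersect \<Omega> x y \<longleftrightarrow> (\<exists>\<alpha>\<in>\<Omega>. x \<alpha> = y \<alpha>)"
proof -
  have "(inv\<^bsub>BijGroup \<Omega>\<^esub> y \<otimes>\<^bsub>BijGroup \<Omega>\<^esub> x) \<alpha> = \<alpha> \<longleftrightarrow> x \<alpha> = y \<alpha>" if a: "\<alpha> \<in> \<Omega>" for \<alpha>
  proof -
    have y: "bij_betw y \<Omega> \<Omega>" using assms(2) by (simp add: Bij_def)
    have xa: "x \<alpha> \<in> \<Omega>" using assms(1) a by (rule Bij_apply)
    have "(inv\<^bsub>BijGroup \<Omega>\<^esub> y \<otimes>\<^bsub>BijGroup \<Omega>\<^esub> x) \<alpha> = inv_into \<Omega> y (x \<alpha>)"
      by (simp add: BijGroup_mult_apply BijGroup_inv_Bij assms a)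
         (simp add: inv_BijGroup assms xa)
    then show ?thesis
      using y xa a by (metis bij_betw_inv_into_left bij_betw_inv_into_right)
  qed
  then show ?thesis unfolding intersect_def by blast
qed

lemma ex_maximum_intersecting_set:
  assumes "finite G"
  shows "\<exists>S. maximum_intersecting_set \<Omega> G S"
proof -
  have fin: "finite (Collect (intersecting_set \<Omega> G))"
    by (rule finite_subset[of _ "Pow G"]) (use assms in \<open>auto simp: intersecting_set_def\<close>)
  have "intersecting_set \<Omega> G {}" by (simp add: intersecting_set_def)
  with fin obtain S where "S \<in> Collect (intersecting_set \<Omega> G)"
      "card S = Max (card ` Collect (intersecting_set \<Omega> G))"
    using Max_in[of "card ` Collect (intersecting_set \<Omega> G)"] by fastforce
  with fin show ?thesis
    by (auto simp: maximum_intersecting_set_def intro!: exI[of _ S] Max_ge)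
qed

lemma rho_eq:
  assumes G: "finite_transitive_group \<Omega> G"
    and S: "maximum_intersecting_set \<Omega> G S" and w: "\<omega> \<in> \<Omega>"
  shows "rho G \<Omega> = real (card S) / real (card (stabilizer (perm_group \<Omega> G) id \<omega>))"
proof -
  interpret transitive_action "perm_group \<Omega> G" \<Omega> id
    using G by (simp add: finite_transitive_group_def)
  have sub: "subgroup G (BijGroup \<Omega>)" and fin: "finite \<Omega>"
    using G by (simp_all add: finite_transitive_group_def)
  have stab: "card (stabilizer (perm_group \<Omega> G) id a) * card \<Omega> = card G" if "a \<in> \<Omega>" for a
  proof -
    have "orbit (perm_group \<Omega> G) id a = \<Omega>"
      using that unique_orbit Bij_apply subgroup_BijGroup_subset[OF sub]
      by (fastforce simp: orbit_def)
    then show ?thesis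
      using orbit_stabilizer_theorem[OF that] by (simp add: order_def mult.commute)
  qed
  have "card (SOME S. maximum_intersecting_set \<Omega> G S) = card S"
  proof (rule le_antisym)
    have "maximum_intersecting_set \<Omega> G (SOME S. maximum_intersecting_set \<Omega> G S)"
      using S by (rule someI)
    then show "card (SOME S. maximum_intersecting_set \<Omega> G S) \<le> card S"
      and "card S \<le> card (SOME S. maximum_intersecting_set \<Omega> G S)"
      using S by (simp_all only: maximum_intersecting_set_def)
  qed
  moreover have "(SOME \<omega>. \<omega> \<in> \<Omega>) \<in> \<Omega>" using w by (rule someI)
  then have "card (stabilizer (perm_group \<Omega> G) id (SOME \<omega>. \<omega> \<in> \<Omega>)) =
      card (stabilizer (perm_group \<Omega> G) id \<omega>)"
    using stab[OF w] stab[of "SOME \<omega>. \<omega> \<in> \<Omega>"] fin w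
    by (metis card_gt_0_iff empty_iff mult_right_cancel not_gr_zero)
  ultimately show ?thesis by (simp add: rho_def)
qed

lemma BijGroup_inv_mult_apply:
  assumes "k \<in> Bij \<Theta>" "k' \<in> Bij \<Theta>" "\<theta> \<in> \<Theta>"
  shows "(inv\<^bsub>BijGroup \<Theta>\<^esub> (k \<otimes>\<^bsub>BijGroup \<Theta>\<^esub> k')) \<theta> =
    (inv\<^bsub>BijGroup \<Theta>\<^esub> k') ((inv\<^bsub>BijGroup \<Theta>\<^esub> k) \<theta>)"
proof -
  have "inv\<^bsub>BijGroup \<Theta>\<^esub> (k \<otimes>\<^bsub>BijGroup \<Theta>\<^esub> k') =
      inv\<^bsub>BijGroup \<Theta>\<^esub> k' \<otimes>\<^bsub>BijGroup \<Theta>\<^esub> inv\<^bsub>BijGroup \<Theta>\<^esub> k"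
    by (rule group.inv_mult_group[OF group_BijGroup]) (simp_all add: BijGroup_def assms)
  then show ?thesis by (simp add: BijGroup_mult_apply BijGroup_inv_Bij assms)
qed

lemma group_wreath_product:
  assumes H: "subgroup H (BijGroup \<Delta>)" and K: "subgroup K (BijGroup \<Theta>)"
  shows "group (wreath_product \<Delta> H \<Theta> K)"
proof -
  interpret D: group "BijGroup \<Delta>" by (rule group_BijGroup)
  interpret T: group "BijGroup \<Theta>" by (rule group_BijGroup)
  interpret H: subgroup H "BijGroup \<Delta>" by (rule H)
  interpret K: subgroup K "BijGroup \<Theta>" by (rule K)
  have KB: "k \<in> Bij \<Theta>" if "k \<in> K" for k using subgroup_BijGroup_subset[OF K] that by blast
  have inv_in: "(inv\<^bsub>BijGroup \<Theta>\<^esub> k) \<theta> \<in> \<Theta>" if "k \<in> K" "\<theta> \<in> \<Theta>" for k \<theta>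
    using Bij_apply[OF BijGroup_inv_Bij[OF KB]] that by blast
  have one_app: "(inv\<^bsub>BijGroup \<Theta>\<^esub> \<one>\<^bsub>BijGroup \<Theta>\<^esub>) \<theta> = \<theta>" if "\<theta> \<in> \<Theta>" for \<theta>
    using that by (simp only: T.inv_one) (simp add: BijGroup_def)
  note inv_mult = BijGroup_inv_mult_apply[OF KB KB]
  show ?thesis
  proof (rule groupI)
    fix x y assume "x \<in> carrier (wreath_product \<Delta> H \<Theta> K)" "y \<in> carrier (wreath_product \<Delta> H \<Theta> K)"
    then show "x \<otimes>\<^bsub>wreath_product \<Delta> H \<Theta> K\<^esub> y \<in> carrier (wreath_product \<Delta> H \<Theta> K)"
      by (auto simp: wreath_product_def PiE_iff inv_in)
  next
    show "\<one>\<^bsub>wreath_product \<Delta> H \<Theta> K\<^esub> \<in> carrier (wreath_product \<Delta> H \<Theta> K)"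
      by (auto simp: wreath_product_def)
  next
    fix x y z
    assume "x \<in> carrier (wreath_product \<Delta> H \<Theta> K)" "y \<in> carrier (wreath_product \<Delta> H \<Theta> K)"
      "z \<in> carrier (wreath_product \<Delta> H \<Theta> K)"
    then show "x \<otimes>\<^bsub>wreath_product \<Delta> H \<Theta> K\<^esub> y \<otimes>\<^bsub>wreath_product \<Delta> H \<Theta> K\<^esub> z =
        x \<otimes>\<^bsub>wreath_product \<Delta> H \<Theta> K\<^esub> (y \<otimes>\<^bsub>wreath_product \<Delta> H \<Theta> K\<^esub> z)"
      by (auto simp: wreath_product_def PiE_iff inv_in inv_mult H.mem_carrier K.mem_carrier
          D.m_assoc T.m_assoc intro!: restrict_ext)
  next
    fix x assume "x \<in> carrier (wreath_product \<Delta> H \<Theta> K)"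
    then obtain h k where x: "x = (h, k)" "h \<in> \<Theta> \<rightarrow>\<^sub>E H" "k \<in> K"
      by (auto simp: wreath_product_def)
    have "(\<lambda>\<theta>\<in>\<Theta>. (\<lambda>\<theta>\<in>\<Theta>. \<one>\<^bsub>BijGroup \<Delta>\<^esub>) \<theta> \<otimes>\<^bsub>BijGroup \<Delta>\<^esub>
        h ((inv\<^bsub>BijGroup \<Theta>\<^esub> \<one>\<^bsub>BijGroup \<Theta>\<^esub>) \<theta>)) = h" (is "?h = h")
    proof (rule extensionalityI[of _ \<Theta>])
      show "?h \<theta> = h \<theta>" if "\<theta> \<in> \<Theta>" for \<theta>
        using x that one_app[OF that] by (simp add: PiE_iff H.mem_carrier del: T.inv_one)
    qed (use x in \<open>auto simp: PiE_iff\<close>)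
    then show "\<one>\<^bsub>wreath_product \<Delta> H \<Theta> K\<^esub> \<otimes>\<^bsub>wreath_product \<Delta> H \<Theta> K\<^esub> x = x"
      using x by (simp add: wreath_product_def K.mem_carrier del: T.inv_one)
  next
    fix x assume "x \<in> carrier (wreath_product \<Delta> H \<Theta> K)"
    then obtain h k where x: "x = (h, k)" "h \<in> \<Theta> \<rightarrow>\<^sub>E H" "k \<in> K"
      by (auto simp: wreath_product_def)
    define y where "y = (\<lambda>\<theta>\<in>\<Theta>. inv\<^bsub>BijGroup \<Delta>\<^esub> (h (k \<theta>)), inv\<^bsub>BijGroup \<Theta>\<^esub> k)"
    have k_in: "k \<theta> \<in> \<Theta>" if "\<theta> \<in> \<Theta>" for \<theta> using Bij_apply[OF KB] x that by blast
    have "y \<in> carrier (wreath_product \<Delta> H \<Theta> K)"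
      using x k_in by (auto simp: y_def wreath_product_def PiE_iff)
    moreover have "y \<otimes>\<^bsub>wreath_product \<Delta> H \<Theta> K\<^esub> x = \<one>\<^bsub>wreath_product \<Delta> H \<Theta> K\<^esub>"
      using x k_in
      by (auto simp: y_def wreath_product_def PiE_iff H.mem_carrier K.mem_carrier
          intro!: restrict_ext)
    ultimately show "\<exists>y\<in>carrier (wreath_product \<Delta> H \<Theta> K).
        y \<otimes>\<^bsub>wreath_product \<Delta> H \<Theta> K\<^esub> x = \<one>\<^bsub>wreath_product \<Delta> H \<Theta> K\<^esub>"
      by blast
  qed
qed

lemma product_action_mult:
  assumes H: "subgroup H (BijGroup \<Delta>)" and K: "subgroup K (BijGroup \<Theta>)"
    and x: "x \<in> carrier (wreath_product \<Delta> H \<Theta> K)" and y: "y \<in> carrier (wreath_product \<Delta> H \<Theta> K)"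
    and f: "f \<in> \<Theta> \<rightarrow>\<^sub>E \<Delta>"
  shows "product_action \<Delta> \<Theta> y f \<in> \<Theta> \<rightarrow>\<^sub>E \<Delta>" (is ?mem)
    and "product_action \<Delta> \<Theta> (x \<otimes>\<^bsub>wreath_product \<Delta> H \<Theta> K\<^esub> y) f =
      product_action \<Delta> \<Theta> x (product_action \<Delta> \<Theta> y f)" (is ?mult)
proof -
  have KB: "k \<in> Bij \<Theta>" if "k \<in> K" for k using subgroup_BijGroup_subset[OF K] that by blast
  have HB: "h \<in> Bij \<Delta>" if "h \<in> H" for h using subgroup_BijGroup_subset[OF H] that by blast
  have inv_in: "(inv\<^bsub>BijGroup \<Theta>\<^esub> k) \<theta> \<in> \<Theta>" if "k \<in> K" "\<theta> \<in> \<Theta>" for k \<theta>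
    using Bij_apply[OF BijGroup_inv_Bij[OF KB]] that by blast
  note inv_mult = BijGroup_inv_mult_apply[OF KB KB]
  obtain h k h' k' where xy: "x = (h, k)" "y = (h', k')" "h \<in> \<Theta> \<rightarrow>\<^sub>E H" "h' \<in> \<Theta> \<rightarrow>\<^sub>E H" "k \<in> K" "k' \<in> K"
    using x y by (auto simp: wreath_product_def)
  have f_in: "f \<theta> \<in> \<Delta>" if "\<theta> \<in> \<Theta>" for \<theta> using f that by (rule PiE_mem)
  have hB: "h \<theta> \<in> Bij \<Delta>" "h' \<theta> \<in> Bij \<Delta>" if "\<theta> \<in> \<Theta>" for \<theta>
    using HB[OF PiE_mem[OF xy(3) that]] HB[OF PiE_mem[OF xy(4) that]] .
  show mem: ?mem
    using f xy(6) by (simp add: product_action_def xy(2) PiE_iff Bij_apply hB f_in inv_in)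
  have "product_action \<Delta> \<Theta> x (product_action \<Delta> \<Theta> y f) =
      (\<lambda>\<theta>\<in>\<Theta>. h \<theta> (product_action \<Delta> \<Theta> y f ((inv\<^bsub>BijGroup \<Theta>\<^esub> k) \<theta>)))"
    using mem by (subst product_action_def) (simp add: xy(1))
  also have "\<dots> = (\<lambda>\<theta>\<in>\<Theta>. h \<theta> (h' ((inv\<^bsub>BijGroup \<Theta>\<^esub> k) \<theta>)
      (f ((inv\<^bsub>BijGroup \<Theta>\<^esub> k') ((inv\<^bsub>BijGroup \<Theta>\<^esub> k) \<theta>)))))"
    using f by (intro restrict_ext) (simp add: product_action_def xy inv_in)
  also have "\<dots> = product_action \<Delta> \<Theta> (x \<otimes>\<^bsub>wreath_product \<Delta> H \<Theta> K\<^esub> y) f"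
    using f xy(5,6)
    by (simp add: product_action_def wreath_product_def xy(1,2))
       (intro restrict_ext, simp add: inv_mult inv_in BijGroup_mult_apply hB f_in)
  finally show ?mult by simp
qed

lemma group_action_product_action:
  assumes H: "subgroup H (BijGroup \<Delta>)" and K: "subgroup K (BijGroup \<Theta>)"
  shows "group_action (wreath_product \<Delta> H \<Theta> K) (\<Theta> \<rightarrow>\<^sub>E \<Delta>) (product_action \<Delta> \<Theta>)"
proof -
  let ?W = "wreath_product \<Delta> H \<Theta> K" and ?A = "product_action \<Delta> \<Theta>" and ?F = "\<Theta> \<rightarrow>\<^sub>E \<Delta>"
  interpret W: group ?W by (rule group_wreath_product[OF H K])
  interpret T: group "BijGroup \<Theta>" by (rule group_BijGroup)
  note mem = product_action_mult(1)[OF H K W.one_closed]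
  note mult = product_action_mult(2)[OF H K]
  have one: "?A \<one>\<^bsub>?W\<^esub> f = f" if f: "f \<in> ?F" for f
  proof -
    have app: "\<one>\<^bsub>BijGroup \<Theta>\<^esub> \<theta> = \<theta>" if "\<theta> \<in> \<Theta>" for \<theta> using that by (simp add: BijGroup_def)
    have app': "\<one>\<^bsub>BijGroup \<Delta>\<^esub> d = d" if "d \<in> \<Delta>" for d using that by (simp add: BijGroup_def)
    show ?thesis
    proof (rule extensionalityI[of _ \<Theta>])
      show "?A \<one>\<^bsub>?W\<^esub> f \<in> extensional \<Theta>"
        using f by (simp add: product_action_def wreath_product_def)
      show "?A \<one>\<^bsub>?W\<^esub> f \<theta> = f \<theta>" if "\<theta> \<in> \<Theta>" for \<theta>
        using f that PiE_mem[OF f that]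
        by (simp add: product_action_def wreath_product_def app app')
    qed (use f in \<open>simp add: PiE_iff\<close>)
  qed
  have ext: "?A x \<in> extensional ?F" for x
    by (cases x) (simp add: product_action_def)
  have Bij: "?A x \<in> Bij ?F" if x: "x \<in> carrier ?W" for x
  proof -
    have "bij_betw (?A x) ?F ?F"
    proof (rule bij_betw_byWitness[where f' = "?A (inv\<^bsub>?W\<^esub> x)"])
      show "\<forall>f\<in>?F. ?A (inv\<^bsub>?W\<^esub> x) (?A x f) = f"
        using x one by (simp flip: mult)
      show "\<forall>f\<in>?F. ?A x (?A (inv\<^bsub>?W\<^esub> x) f) = f"
        using x one by (simp flip: mult)
    qed (use x mem W.inv_closed in blast)+
    then show ?thesis using ext by (simp add: Bij_def)
  qed
  have "?A \<in> hom ?W (BijGroup ?F)"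
  proof (rule homI)
    fix x assume "x \<in> carrier ?W"
    then show "?A x \<in> carrier (BijGroup ?F)" using Bij by (simp add: BijGroup_def)
  next
    fix x y assume xy: "x \<in> carrier ?W" "y \<in> carrier ?W"
    then have "?A (x \<otimes>\<^bsub>?W\<^esub> y) = compose ?F (?A x) (?A y)"
      by (intro extensionalityI[OF ext compose_extensional]) (simp add: mult compose_eq)
    then show "?A (x \<otimes>\<^bsub>?W\<^esub> y) = ?A x \<otimes>\<^bsub>BijGroup ?F\<^esub> ?A y"
      using xy Bij by (simp add: BijGroup_def)
  qed
  then show ?thesis
    by (simp add: group_action_def group_hom_def group_hom_axioms_def W.is_group group_BijGroup)
qed

lemma equiv_perm_equiv_rel:
  "equiv {(\<Omega> :: 'a set, G). subgroup G (BijGroup \<Omega>)} perm_equiv_rel"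
  (is "equiv ?P ?R")
proof (rule equivI)
  show "?R \<subseteq> ?P \<times> ?P"
    by (auto simp: perm_equiv_rel_def)
  show "refl_on ?P ?R"
    by (auto simp: refl_on_def perm_equiv_rel_def perm_equivalent_def iso_def hom_def
        intro!: exI[of _ id])
  show "sym ?R"
  proof (rule symI, clarify)
    fix \<Omega> :: "'a set" and G \<Omega>' G' assume "((\<Omega>, G), (\<Omega>', G')) \<in> perm_equiv_rel"
    then obtain f \<eta> where sub: "subgroup G (BijGroup \<Omega>)" "subgroup G' (BijGroup \<Omega>')"
      and f: "bij_betw f \<Omega> \<Omega>'" and e: "\<eta> \<in> iso (perm_group \<Omega> G) (perm_group \<Omega>' G')"
      and eq: "\<forall>g\<in>G. \<forall>a\<in>\<Omega>. f (g a) = \<eta> g (f a)"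
      by (auto simp: perm_equiv_rel_def perm_equivalent_def)
    have grp: "group (perm_group \<Omega> G)"
      by (rule subgroup.subgroup_is_group[OF sub(1) group_BijGroup])
    have e': "inv_into G \<eta> \<in> iso (perm_group \<Omega>' G') (perm_group \<Omega> G)"
      using group.iso_set_sym[OF grp e] by simp
    have bij: "bij_betw \<eta> G G'" using e by (simp add: iso_def)
    have "inv_into \<Omega> f (g a) = (inv_into G \<eta> g) (inv_into \<Omega> f a)" if "g \<in> G'" "a \<in> \<Omega>'" for g a
    proof -
      have g: "inv_into G \<eta> g \<in> G" "\<eta> (inv_into G \<eta> g) = g"
        using bij that by (auto simp: bij_betw_def inv_into_into f_inv_into_f)
      have a: "inv_into \<Omega> f a \<in> \<Omega>" "f (inv_into \<Omega> f a) = a"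
        using f that by (auto simp: bij_betw_def inv_into_into f_inv_into_f)
      have "f ((inv_into G \<eta> g) (inv_into \<Omega> f a)) = g a" using eq g a by auto
      moreover have "(inv_into G \<eta> g) (inv_into \<Omega> f a) \<in> \<Omega>"
        by (rule Bij_apply[OF subsetD[OF subgroup_BijGroup_subset[OF sub(1)] g(1)] a(1)])
      ultimately show ?thesis using f by (metis bij_betw_inv_into_left)
    qed
    then have "perm_equivalent (perm_group \<Omega>' G') \<Omega>' id (perm_group \<Omega> G) \<Omega> id"
      unfolding perm_equivalent_def using e' bij_betw_inv_into[OF f]
      by (intro exI[of _ "inv_into \<Omega> f"] exI[of _ "inv_into G \<eta>"]) simp
    then show "((\<Omega>', G'), (\<Omega>, G)) \<in> perm_equiv_rel"
      using sub by (simp add: perm_equiv_rel_def)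
  qed
  show "trans ?R"
  proof (rule transI, clarify)
    fix \<Omega> :: "'a set" and G \<Omega>' G' \<Omega>'' G''
    assume "((\<Omega>, G), (\<Omega>', G')) \<in> perm_equiv_rel" "((\<Omega>', G'), (\<Omega>'', G'')) \<in> perm_equiv_rel"
    then obtain f \<eta> f' \<eta>' where sub: "subgroup G (BijGroup \<Omega>)" "subgroup G'' (BijGroup \<Omega>'')"
      and f: "bij_betw f \<Omega> \<Omega>'" "bij_betw f' \<Omega>' \<Omega>''"
      and e: "\<eta> \<in> iso (perm_group \<Omega> G) (perm_group \<Omega>' G')"
        "\<eta>' \<in> iso (perm_group \<Omega>' G') (perm_group \<Omega>'' G'')"
      and eq: "\<forall>g\<in>G. \<forall>a\<in>\<Omega>. f (g a) = \<eta> g (f a)" "\<forall>g\<in>G'. \<forall>a\<in>\<Omega>'. f' (g a) = \<eta>' g (f' a)"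
      by (auto simp: perm_equiv_rel_def perm_equivalent_def)
    have "\<eta> g \<in> G'" if "g \<in> G" for g using e that by (auto simp: iso_def bij_betw_def)
    moreover have "f a \<in> \<Omega>'" if "a \<in> \<Omega>" for a using f that by (auto simp: bij_betw_def)
    ultimately have "\<forall>g\<in>G. \<forall>a\<in>\<Omega>. (f' \<circ> f) (g a) = (\<eta>' \<circ> \<eta>) g ((f' \<circ> f) a)"
      using eq by simp
    then have "perm_equivalent (perm_group \<Omega> G) \<Omega> id (perm_group \<Omega>'' G'') \<Omega>'' id"
      unfolding perm_equivalent_def using bij_betw_trans[OF f] iso_set_trans[OF e]
      by (intro exI[of _ "f' \<circ> f"] exI[of _ "\<eta>' \<circ> \<eta>"]) simp
    then show "((\<Omega>, G), (\<Omega>'', G'')) \<in> perm_equiv_rel"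
      using sub by (simp add: perm_equiv_rel_def)
  qed
qed

end

theory Submission
  imports Defs "HOL-Library.Numeral_Type"
begin

text \<open>
  For the wreath product with trivial top group, that is, the direct power \<open>H\<^sup>n\<close> acting on
  \<open>\<Delta>\<^sup>n\<close>, powers of intersecting sets of \<open>H\<close> are intersecting, so \<open>\<rho>(H\<^sup>n) \<ge> \<rho>(H)\<^sup>n\<close>. Hence one
  group \<open>H\<close> with \<open>\<rho>(H) > \<surd>|\<Delta>|\<close> suffices. Take the 18 planes \<open>x\<^bsub>i+1\<^esub> = \<plusminus> x\<^bsub>i\<^esub> + c\<close> of the space
  \<open>(\<int>/3)\<^sup>3\<close>, permuted transitively by the maps \<open>x\<^bsub>i\<^esub> \<mapsto> s\<^bsub>i\<^esub> x\<^bsub>i\<^esub> + t\<^bsub>i\<^esub>\<close> with \<open>s\<^bsub>i\<^esub> = \<plusminus>1\<close> and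
  \<open>s\<^bsub>0\<^esub> s\<^bsub>1\<^esub> s\<^bsub>2\<^esub> = 1\<close> together with the cyclic shifts of coordinates. Such a map fixes a plane
  \<open>x\<^bsub>i+1\<^esub> = e x\<^bsub>i\<^esub> + c\<close> exactly when its coordinates \<open>i\<close> and \<open>i + 1\<close> are conjugate in \<open>Sym(3)\<close>,
  via \<open>x \<mapsto> e x + c\<close>. By parity and the pigeonhole principle two of the three coordinates are conjugate,
  so the maps without shift form an intersecting subgroup of index at most 3, and \<open>\<rho> \<ge> 18/3 = 6 > \<surd>18\<close>.
\<close>

section \<open>The ratio rho in terms of group order and degree\<close>

lemma card_eq_card_stabilizer_times:
  assumes "finite_transitive_group \<Omega> G" "\<omega> \<in> \<Omega>"
  shows "card G = card (stabilizer (perm_group \<Omega> G) id \<omega>) * card \<Omega>"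
proof -
  interpret transitive_action "perm_group \<Omega> G" \<Omega> id
    using assms(1) by (simp add: finite_transitive_group_def)
  have "orbit (perm_group \<Omega> G) id \<omega> = \<Omega>"
    using unique_orbit[OF assms(2)] element_image[OF _ assms(2)]
    by (fastforce simp: orbit_def)
  then show ?thesis
    using orbit_stabilizer_theorem[OF assms(2)] by (simp add: order_def mult.commute)
qed

lemma finite_transitive_group_finite:
  assumes "finite_transitive_group \<Omega> G"
  shows "finite G" "card G > 0"
proof -
  have sub: "subgroup G (BijGroup \<Omega>)" and fin: "finite \<Omega>"
    using assms by (simp_all add: finite_transitive_group_def)
  show "finite G"
    using finite_subset[OF subgroup_BijGroup_subset[OF sub] finite_Bij[OF fin]] .
  then show "card G > 0"
    using subgroup.one_closed[OF sub] by (auto simp: card_gt_0_iff)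
qed

text \<open>Orbit-stabilizer gives a point stabilizer the order
  \<open>card G / card \<Omega>\<close>. In this form rho is built from three cardinalities, each of
  which becomes an n-th power in a direct power.\<close>

lemma rho_eq_maximum:
  assumes G: "finite_transitive_group \<Omega> G" and S: "maximum_intersecting_set \<Omega> G S"
  shows "rho G \<Omega> = real (card S) * real (card \<Omega>) / real (card G)"
proof -
  obtain \<omega> where w: "\<omega> \<in> \<Omega>"
    using G by (auto simp: finite_transitive_group_def)
  show ?thesis
    using card_eq_card_stabilizer_times[OF G w] finite_transitive_group_finite[OF G]
    by (simp add: rho_eq[OF G S w] field_simps)
qed

lemma rho_ge:
  assumes G: "finite_transitive_group \<Omega> G" and S: "intersecting_set \<Omega> G S"
  shows "rho G \<Omega> \<ge> real (card S) * real (card \<Omega>) / real (card G)"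
proof -
  obtain T where T: "maximum_intersecting_set \<Omega> G T"
    using ex_maximum_intersecting_set finite_transitive_group_finite[OF G] by blast
  then have "card S \<le> card T"
    using S by (simp add: maximum_intersecting_set_def)
  then show ?thesis
    by (simp add: rho_eq_maximum[OF G T] divide_right_mono mult_right_mono)
qed

section \<open>Transport of group actions to sets of naturals\<close>

text \<open>Wreath products and the plane group act on sets of other types, while the final
  statement asks for permutation groups on naturals. Conjugation by a numbering of \<open>F\<close>
  transports the action. Faithfulness preserves the group order, and pairwise agreement in
  \<open>S\<close> becomes intersection, so \<open>S\<close> bounds rho from below.\<close>

lemma ex_perm_group_of_action:
  fixes W (structure)
  assumes faith: "faithful_action W F \<phi>" and trans: "transitive_action W F \<phi>"
    and F: "finite F" "F \<noteq> {}"
    and S: "S \<subseteq> carrier W" "\<And>x y. x \<in> S \<Longrightarrow> y \<in> S \<Longrightarrow> \<exists>a\<in>F. \<phi> x a = \<phi> y a"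
  obtains \<Omega> :: "nat set" and G where
    "finite_transitive_group \<Omega> G" "card \<Omega> = card F"
    "perm_equivalent (perm_group \<Omega> G) \<Omega> id W F \<phi>"
    "rho G \<Omega> \<ge> real (card S) * real (card F) / real (card (carrier W))"
proof -
  interpret faithful_action W F \<phi> by (rule faith)
  interpret transitive_action W F \<phi> by (rule trans)
  interpret W: group_hom W "BijGroup F" \<phi> by (rule group_hom)
  define \<Omega> where "\<Omega> = {0..<card F}"
  obtain f where f: "bij_betw f F \<Omega>"
    using ex_bij_betw_finite_nat[OF F(1)] unfolding \<Omega>_def by blast
  define f' where "f' = inv_into F f"
  have f': "bij_betw f' \<Omega> F" unfolding f'_def by (rule bij_betw_inv_into[OF f])
  have ff': "f (f' w) = w" if "w \<in> \<Omega>" for w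
    unfolding f'_def using bij_betw_inv_into_right[OF f that] .
  have f'f: "f' (f a) = a" if "a \<in> F" for a
    unfolding f'_def using bij_betw_inv_into_left[OF f that] .
  have f'_in: "f' w \<in> F" if "w \<in> \<Omega>" for w using f' that by (auto simp: bij_betw_def)
  have f_in: "f a \<in> \<Omega>" if "a \<in> F" for a using f that by (auto simp: bij_betw_def)
  have \<phi>_in: "\<phi> g a \<in> F" if "g \<in> carrier W" "a \<in> F" for g a using element_image that by blast
  \<comment> \<open>The restriction makes \<open>\<eta> g\<close> extensional, as membership in
    \<open>Bij \<Omega>\<close> demands.\<close>
  define \<eta> where "\<eta> g = (\<lambda>w\<in>\<Omega>. f (\<phi> g (f' w)))" for g
  define G where "G = \<eta> ` carrier W"
  have \<eta>_Bij: "\<eta> g \<in> Bij \<Omega>" if g: "g \<in> carrier W" for g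
  proof -
    have "bij_betw (\<phi> g) F F" using bij_prop0[OF g] by (simp add: Bij_def)
    then have "bij_betw (f \<circ> (\<phi> g \<circ> f')) \<Omega> \<Omega>"
      by (intro bij_betw_trans[OF _ f] bij_betw_trans[OF f'])
    then show ?thesis
      unfolding Bij_def \<eta>_def by (simp add: o_def bij_betw_restrict_eq)
  qed
  have hom: "\<eta> \<in> hom W (BijGroup \<Omega>)"
  proof (rule homI)
    fix g h assume gh: "g \<in> carrier W" "h \<in> carrier W"
    have "\<eta> (g \<otimes> h) = compose \<Omega> (\<eta> g) (\<eta> h)"
      by (rule extensionalityI[of _ \<Omega>])
        (auto simp: \<eta>_def compose_def composition_rule gh f'_in f_in f'f \<phi>_in
          simp del: W.hom_mult)
    then show "\<eta> (g \<otimes> h) = \<eta> g \<otimes>\<^bsub>BijGroup \<Omega>\<^esub> \<eta> h"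
      using gh \<eta>_Bij by (simp add: BijGroup_def)
  qed (use \<eta>_Bij in \<open>simp add: BijGroup_def\<close>)
  interpret E: group_hom W "BijGroup \<Omega>" \<eta>
    by (intro group_hom.intro group_hom_axioms.intro W.G.is_group group_BijGroup hom)
  have sub: "subgroup G (BijGroup \<Omega>)"
    unfolding G_def by (rule E.img_is_subgroup)
  have app: "\<eta> g (f a) = f (\<phi> g a)" if "a \<in> F" for g a
    using that by (simp add: \<eta>_def f_in f'f)
  have inj: "inj_on \<eta> (carrier W)"
  proof (rule inj_onI)
    fix g h assume gh: "g \<in> carrier W" "h \<in> carrier W" "\<eta> g = \<eta> h"
    have "\<phi> g = \<phi> h"
    proof (rule extensionalityI[of _ F])
      fix a assume a: "a \<in> F"
      then have "f (\<phi> g a) = f (\<phi> h a)" using app[OF a] gh(3) by metis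
      then show "\<phi> g a = \<phi> h a" using f'f \<phi>_in gh a by metis
    qed (use bij_prop0 gh Bij_imp_extensional in auto)
    then show "g = h" using faithful gh by (auto dest: inj_onD)
  qed
  have card_G: "card G = card (carrier W)"
    unfolding G_def by (rule card_image[OF inj])
  have iso: "\<eta> \<in> iso W (perm_group \<Omega> G)"
    using hom inj by (auto simp: iso_def hom_def bij_betw_def G_def)
  have "perm_equivalent (perm_group \<Omega> G) \<Omega> id W F \<phi>"
    unfolding perm_equivalent_def
  proof (intro exI conjI ballI)
    show "bij_betw f' \<Omega> F" by (rule f')
    show "inv_into (carrier W) \<eta> \<in> iso (perm_group \<Omega> G) W"
      by (rule W.G.iso_set_sym[OF iso])
    fix g w assume "g \<in> carrier (perm_group \<Omega> G)" and w: "w \<in> \<Omega>"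
    then obtain x where x: "x \<in> carrier W" "g = \<eta> x" by (auto simp: G_def)
    then have "f' (\<eta> x w) = \<phi> x (f' w)"
      using w by (simp add: \<eta>_def f'f \<phi>_in f'_in)
    then show "f' (id g w) = \<phi> (inv_into (carrier W) \<eta> g) (f' w)"
      using x inj by simp
  qed
  moreover have ft: "finite_transitive_group \<Omega> G"
    unfolding finite_transitive_group_def
  proof (intro conjI)
    show "finite \<Omega>" "\<Omega> \<noteq> {}" using F by (simp_all add: \<Omega>_def card_gt_0_iff)
    interpret P: group "perm_group \<Omega> G"
      by (rule subgroup.subgroup_is_group[OF sub group_BijGroup])
    show "transitive_action (perm_group \<Omega> G) \<Omega> id"
    proof unfold_locales
      show "id \<in> hom (perm_group \<Omega> G) (BijGroup \<Omega>)"
        using subgroup.subset[OF sub] by (auto simp: hom_def)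
      fix v w assume vw: "v \<in> \<Omega>" "w \<in> \<Omega>"
      obtain g where "g \<in> carrier W" "\<phi> g (f' v) = f' w"
        using unique_orbit[OF f'_in f'_in, OF vw] by blast
      then show "\<exists>g\<in>carrier (perm_group \<Omega> G). id g v = w"
        using vw by (auto simp: G_def \<eta>_def ff' intro!: bexI[of _ g])
    qed
  qed (rule sub)
  moreover have "card \<Omega> = card F" by (simp add: \<Omega>_def)
  moreover have "intersecting_set \<Omega> G (\<eta> ` S)"
    unfolding intersecting_set_def
  proof (intro conjI ballI)
    show "\<eta> ` S \<subseteq> G" using S by (auto simp: G_def)
    fix x y assume "x \<in> \<eta> ` S" "y \<in> \<eta> ` S"
    then obtain g h where gh: "g \<in> S" "h \<in> S" "x = \<eta> g" "y = \<eta> h" by blast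
    then obtain a where "a \<in> F" "\<phi> g a = \<phi> h a" using S(2) by blast
    then have "x (f a) = y (f a)" "f a \<in> \<Omega>" using gh app f_in by auto
    then show "intersect \<Omega> x y"
      using intersect_iff[OF \<eta>_Bij \<eta>_Bij, of g h] gh S(1) by blast
  qed
  moreover have "card (\<eta> ` S) = card S"
    by (rule card_image[OF inj_on_subset[OF inj S(1)]])
  ultimately show thesis
    using that rho_ge[OF ft, of "\<eta> ` S"] card_G by simp
qed

section \<open>Direct powers in product action\<close>

text \<open>With the trivial top group \<open>K\<close> the wreath product acts coordinatewise, so
  faithfulness, transitivity and agreement of two elements at a point can all be settled one
  coordinate at a time.\<close>

lemma admits_product_decomposition_power:
  fixes \<Delta> :: "nat set"
  assumes H: "finite_transitive_group \<Delta> H" and \<Delta>: "2 \<le> card \<Delta>" and n: "2 \<le> n"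
  obtains \<Omega> :: "nat set" and G where
    "finite_transitive_group \<Omega> G" "admits_product_decomposition \<Omega> G"
    "card \<Omega> = card \<Delta> ^ n" "rho G \<Omega> \<ge> rho H \<Delta> ^ n"
proof -
  define \<Theta> where "\<Theta> = {0..<n}"
  define K where "K = {\<one>\<^bsub>BijGroup \<Theta>\<^esub>}"
  let ?W = "wreath_product \<Delta> H \<Theta> K" and ?A = "product_action \<Delta> \<Theta>" and ?F = "\<Theta> \<rightarrow>\<^sub>E \<Delta>"
  have fin: "finite \<Theta>" and card_\<Theta>: "card \<Theta> = n" by (simp_all add: \<Theta>_def)
  have sub: "subgroup H (BijGroup \<Delta>)" and fin\<Delta>: "finite \<Delta>" "\<Delta> \<noteq> {}"
    using H by (simp_all add: finite_transitive_group_def)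
  interpret H: transitive_action "perm_group \<Delta> H" \<Delta> id
    using H by (simp add: finite_transitive_group_def)
  have subK: "subgroup K (BijGroup \<Theta>)"
    unfolding K_def by (rule group.triv_subgroup[OF group_BijGroup])
  have carrier: "carrier ?W = (\<Theta> \<rightarrow>\<^sub>E H) \<times> K" by (simp add: wreath_product_def)
  have app: "?A (h, k) f = (\<lambda>\<theta>\<in>\<Theta>. h \<theta> (f \<theta>))" if "k \<in> K" "f \<in> ?F" for h k f
  proof -
    have "(inv\<^bsub>BijGroup \<Theta>\<^esub> k) \<theta> = \<theta>" if "\<theta> \<in> \<Theta>" for \<theta>
      using \<open>k \<in> K\<close> that group.is_monoid[OF group_BijGroup, of \<Theta>]
      by (simp add: K_def monoid.inv_one) (simp add: BijGroup_def)
    then show ?thesis using that by (auto simp: product_action_def)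
  qed
  have HB: "x \<in> Bij \<Delta>" if "x \<in> H" for x
    using subgroup_BijGroup_subset[OF sub] that by blast
  interpret A: group_action ?W ?F ?A by (rule group_action_product_action[OF sub subK])
  have faith: "faithful_action ?W ?F ?A"
  proof
    show "inj_on ?A (carrier ?W)"
    proof (rule inj_onI)
      fix x y assume xy: "x \<in> carrier ?W" "y \<in> carrier ?W" "?A x = ?A y"
      obtain h k h' k' where hk: "x = (h, k)" "y = (h', k')" "h \<in> \<Theta> \<rightarrow>\<^sub>E H" "h' \<in> \<Theta> \<rightarrow>\<^sub>E H"
        "k \<in> K" "k' \<in> K"
        using xy by (auto simp: carrier)
      have "h = h'"
      proof (rule PiE_ext[OF hk(3,4)])
        fix \<theta> assume \<theta>: "\<theta> \<in> \<Theta>"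
        have "h \<theta> d = h' \<theta> d" if d: "d \<in> \<Delta>" for d
        proof -
          have "(\<lambda>_\<in>\<Theta>. d) \<in> ?F" using d by simp
          then have "(\<lambda>\<eta>\<in>\<Theta>. h \<eta> ((\<lambda>_\<in>\<Theta>. d) \<eta>)) = (\<lambda>\<eta>\<in>\<Theta>. h' \<eta> ((\<lambda>_\<in>\<Theta>. d) \<eta>))"
            using xy(3) app[OF hk(5)] app[OF hk(6)] hk(1,2) by metis
          from fun_cong[OF this, of \<theta>] show ?thesis using \<theta> by simp
        qed
        then show "h \<theta> = h' \<theta>"
          using HB[OF PiE_mem[OF hk(3) \<theta>]] HB[OF PiE_mem[OF hk(4) \<theta>]]
          by (intro extensionalityI[of _ \<Delta>]) (auto dest: Bij_imp_extensional)
      qed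
      then show "x = y" using hk by (simp add: K_def)
    qed
  qed
  have trans: "transitive_action ?W ?F ?A"
  proof
    fix f g assume fg: "f \<in> ?F" "g \<in> ?F"
    have "\<exists>x\<in>H. x (f \<theta>) = g \<theta>" if "\<theta> \<in> \<Theta>" for \<theta>
      using H.unique_orbit[OF PiE_mem[OF fg(1) that] PiE_mem[OF fg(2) that]] by simp
    then obtain h where h: "\<And>\<theta>. \<theta> \<in> \<Theta> \<Longrightarrow> h \<theta> \<in> H \<and> h \<theta> (f \<theta>) = g \<theta>" by metis
    have "?A (restrict h \<Theta>, \<one>\<^bsub>BijGroup \<Theta>\<^esub>) f = g"
      using fg h by (subst app) (auto simp: K_def PiE_iff intro!: extensionalityI[of _ \<Theta>])
    then show "\<exists>x\<in>carrier ?W. ?A x f = g"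
    proof (rule bexI)
      show "(restrict h \<Theta>, \<one>\<^bsub>BijGroup \<Theta>\<^esub>) \<in> carrier ?W"
        unfolding carrier using h by (auto simp: K_def)
    qed
  qed
  obtain T where T: "maximum_intersecting_set \<Delta> H T"
    using ex_maximum_intersecting_set finite_transitive_group_finite(1)[OF H] by blast
  then have TH: "T \<subseteq> H" and Tint: "\<And>x y. x \<in> T \<Longrightarrow> y \<in> T \<Longrightarrow> intersect \<Delta> x y"
    by (auto simp: maximum_intersecting_set_def intersecting_set_def)
  define S where "S = (\<Theta> \<rightarrow>\<^sub>E T) \<times> K"
  have "S \<subseteq> carrier ?W" using TH by (auto simp: S_def carrier PiE_iff)
  moreover have "\<exists>f\<in>?F. ?A x f = ?A y f" if "x \<in> S" "y \<in> S" for x y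
  proof -
    obtain h k h' k' where hk: "x = (h, k)" "y = (h', k')" "h \<in> \<Theta> \<rightarrow>\<^sub>E T" "h' \<in> \<Theta> \<rightarrow>\<^sub>E T"
      "k \<in> K" "k' \<in> K"
      using \<open>x \<in> S\<close> \<open>y \<in> S\<close> by (auto simp: S_def)
    have "\<exists>d\<in>\<Delta>. h \<theta> d = h' \<theta> d" if \<theta>: "\<theta> \<in> \<Theta>" for \<theta>
    proof -
      have "h \<theta> \<in> T" "h' \<theta> \<in> T" using hk \<theta> by (auto simp: PiE_iff)
      then show ?thesis
        using Tint[of "h \<theta>" "h' \<theta>"] intersect_iff[OF HB HB, of "h \<theta>" "h' \<theta>"] TH by blast
    qed
    \<comment> \<open>The points of agreement are chosen independently in each coordinate and
      together form one point of the product.\<close>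
    then obtain f where f: "\<And>\<theta>. \<theta> \<in> \<Theta> \<Longrightarrow> f \<theta> \<in> \<Delta> \<and> h \<theta> (f \<theta>) = h' \<theta> (f \<theta>)" by metis
    then have "restrict f \<Theta> \<in> ?F" by simp
    moreover from this have "?A x (restrict f \<Theta>) = ?A y (restrict f \<Theta>)"
      using f hk by (auto simp: app intro!: restrict_ext)
    ultimately show ?thesis by blast
  qed
  moreover have "finite ?F" "?F \<noteq> {}"
    using fin fin\<Delta> by (auto simp: finite_PiE PiE_eq_empty_iff)
  ultimately obtain \<Omega> :: "nat set" and G where G: "finite_transitive_group \<Omega> G" "card \<Omega> = card ?F"
    "perm_equivalent (perm_group \<Omega> G) \<Omega> id ?W ?F ?A"
    "rho G \<Omega> \<ge> real (card S) * real (card ?F) / real (card (carrier ?W))"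
    using ex_perm_group_of_action[OF faith trans] by metis
  have "admits_product_decomposition \<Omega> G"
    unfolding admits_product_decomposition_def using \<Delta> n card_\<Theta> sub subK G(3) by blast
  moreover have "card \<Omega> = card \<Delta> ^ n"
    using G(2) fin card_\<Theta> by (simp add: card_PiE)
  \<comment> \<open>An equality, since \<open>K\<close> has one element and \<open>T\<close> is
    maximum.\<close>
  moreover have "rho H \<Delta> ^ n = real (card S) * real (card ?F) / real (card (carrier ?W))"
    using fin card_\<Theta> unfolding carrier S_def rho_eq_maximum[OF H T]
    by (simp add: card_PiE card_cartesian_product K_def power_divide power_mult_distrib)
  ultimately show thesis using that G by simp
qed

section \<open>Separating equivalence classes by degree\<close>

lemma perm_equiv_rel_card: "((\<Omega>, G), (\<Omega>', G')) \<in> perm_equiv_rel \<Longrightarrow> card \<Omega> = card \<Omega>'"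
  by (auto simp: perm_equiv_rel_def perm_equivalent_def dest: bij_betw_same_card)

text \<open>The degree is constant on each class, so infinitely many degrees force infinitely many
  classes.\<close>

lemma infinite_quotient_perm_equiv_rel:
  assumes X: "\<And>\<Omega> G. (\<Omega>, G) \<in> X \<Longrightarrow> subgroup G (BijGroup \<Omega>)"
    and inf: "infinite ((\<lambda>(\<Omega>, G). card \<Omega>) ` X)"
  shows "infinite (X // perm_equiv_rel)"
proof
  assume fin: "finite (X // perm_equiv_rel)"
  \<comment> \<open>\<open>q\<close> reads the degree off an arbitrary representative; any choice
    gives the same value by \<open>perm_equiv_rel_card\<close>.\<close>
  define q where "q c = (let (\<Omega>, G) = SOME p. p \<in> c in card \<Omega>)"
    for c :: "('a set \<times> ('a \<Rightarrow> 'a) set) set"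
  have "(\<lambda>(\<Omega>, G). card \<Omega>) ` X \<subseteq> q ` (X // perm_equiv_rel)"
  proof clarsimp
    fix \<Omega> G assume x: "(\<Omega>, G) \<in> X"
    let ?c = "perm_equiv_rel `` {(\<Omega>, G)}"
    have "(\<Omega>, G) \<in> ?c"
      using X[OF x] equiv_class_self[OF equiv_perm_equiv_rel] by blast
    then have "(SOME p. p \<in> ?c) \<in> ?c" by (rule someI)
    then have "card \<Omega> = q ?c"
      by (auto simp: q_def split: prod.split dest: perm_equiv_rel_card)
    then show "card \<Omega> \<in> q ` (X // perm_equiv_rel)"
      using quotientI[OF x] by blast
  qed
  with inf fin show False using finite_surj by blast
qed

section \<open>Arithmetic modulo 3 and signs\<close>

lemma UNIV_3: "(UNIV :: 3 set) = {0, 1, 2}"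
proof -
  have "card {0, 1, 2 :: 3} = CARD(3)" by simp
  then show ?thesis by (metis card_eq_UNIV_imp_eq_UNIV finite)
qed

lemma cases_3: "x = 0 \<or> x = 1 \<or> x = -1" for x :: 3
proof -
  have "(2::3) = -1" by simp
  moreover have "x \<in> {0, 1, 2}" unfolding UNIV_3[symmetric] by (rule UNIV_I)
  ultimately show ?thesis by (metis insertE emptyE)
qed

definition signs :: "3 set" where "signs = {1, -1}"

lemma signs_square: "e \<in> signs \<Longrightarrow> e * e = 1" by (auto simp: signs_def)
lemma signs_mult: "e \<in> signs \<Longrightarrow> e' \<in> signs \<Longrightarrow> e * e' \<in> signs" by (auto simp: signs_def)
lemma nonzero_signs: "x \<noteq> 0 \<Longrightarrow> x \<in> signs" using cases_3[of x] by (auto simp: signs_def)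

section \<open>The transitive group on 18 planes\<close>

text \<open>
  The triple \<open>(i, e, c)\<close> encodes the plane \<open>x\<^bsub>i+1\<^esub> = e x\<^bsub>i\<^esub> + c\<close> of \<open>(\<int>/3)\<^sup>3\<close>, and
  \<open>plane_map s t j\<close> is the action on planes of the affine map sending \<open>x\<close> to the \<open>y\<close> with
  \<open>y\<^bsub>i+j\<^esub> = s\<^bsub>i+j\<^esub> x\<^bsub>i\<^esub> + t\<^bsub>i+j\<^esub>\<close>. Coordinates are indexed by \<open>\<int>/3\<close>, and \<open>s = 1/s\<close> for signs.
\<close>

definition planes :: "(3 \<times> 3 \<times> 3) set" where "planes = UNIV \<times> signs \<times> UNIV"

definition even_signs :: "(3 \<Rightarrow> 3) set" where
  "even_signs = {s. range s \<subseteq> signs \<and> (\<Prod>i\<in>UNIV. s i) = 1}"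

definition plane_map :: "(3 \<Rightarrow> 3) \<Rightarrow> (3 \<Rightarrow> 3) \<Rightarrow> 3 \<Rightarrow> 3 \<times> 3 \<times> 3 \<Rightarrow> 3 \<times> 3 \<times> 3" where
  "plane_map s t j = (\<lambda>(i, e, c)\<in>planes. (i + j, s (i + j + 1) * e * s (i + j),
     s (i + j + 1) * c + t (i + j + 1) - s (i + j + 1) * e * s (i + j) * t (i + j)))"

definition plane_group where "plane_group = {plane_map s t j | s t j. s \<in> even_signs}"
definition even_plane_group where "even_plane_group = {plane_map s t 0 | s t. s \<in> even_signs}"

lemma even_signsD: "s \<in> even_signs \<Longrightarrow> s i \<in> signs" by (auto simp: even_signs_def)

lemma even_signs_mult: "s \<in> even_signs \<Longrightarrow> s' \<in> even_signs \<Longrightarrow> (\<lambda>i. s i * s' i) \<in> even_signs"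
  by (auto simp: even_signs_def image_subset_iff signs_mult prod.distrib)

lemma even_signs_shift: "s \<in> even_signs \<Longrightarrow> (\<lambda>i. s (i + j)) \<in> even_signs"
proof -
  have "(\<Prod>i\<in>UNIV. s (i + j)) = (\<Prod>i\<in>UNIV. s i)"
    by (rule prod.reindex_bij_witness[of _ "\<lambda>i. i - j" "\<lambda>i. i + j"]) auto
  then show "s \<in> even_signs \<Longrightarrow> ?thesis" by (auto simp: even_signs_def)
qed

lemma even_signs_one: "(\<lambda>_. 1) \<in> even_signs"
  by (auto simp: even_signs_def signs_def)

lemma plane_map_in: "s \<in> even_signs \<Longrightarrow> a \<in> planes \<Longrightarrow> plane_map s t j a \<in> planes"
  by (auto simp: plane_map_def planes_def intro!: signs_mult dest: even_signsD)

text \<open>This is composition of the underlying affine maps. Signs and translations are indexed by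
  the target coordinate, so the later shift \<open>j\<close> moves those of the first map, hence
  \<open>i - j\<close>.\<close>

lemma plane_map_mult:
  assumes "s \<in> even_signs" "s' \<in> even_signs"
  shows "compose planes (plane_map s t j) (plane_map s' t' j') =
    plane_map (\<lambda>i. s i * s' (i - j)) (\<lambda>i. s i * t' (i - j) + t i) (j + j')"
proof (rule extensionalityI[of _ planes])
  fix a assume a: "a \<in> planes"
  obtain i e c where aa: "a = (i, e, c)" by (cases a)
  define k where "k = i + j'"
  have *: "i + (j + j') = k + j" "i + j' = k" "k + j + 1 - j = k + 1" "k + j - j = k"
    by (simp_all add: k_def)
  have sq: "s (j + k) * s (j + k) = 1" using assms by (simp add: even_signsD signs_square)
  have sq': "s (j + k) * (s (j + k) * x) = x" for x using sq by (simp flip: mult.assoc)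
  show "compose planes (plane_map s t j) (plane_map s' t' j') a =
    plane_map (\<lambda>i. s i * s' (i - j)) (\<lambda>i. s i * t' (i - j) + t i) (j + j') a"
    using a plane_map_in[OF assms(2) a, of t' j'] unfolding aa
    by (simp add: compose_def plane_map_def * algebra_simps sq')
qed (simp_all add: plane_map_def)

lemma plane_map_one: "plane_map (\<lambda>_. 1) (\<lambda>_. 0) 0 = (\<lambda>a\<in>planes. a)"
  by (auto simp: plane_map_def)

text \<open>Solving \<open>y (i + j) = s (i + j) * x i + t (i + j)\<close> for \<open>x i\<close>
  gives \<open>g\<close>, because every sign is its own inverse.\<close>

lemma plane_map_inv:
  fixes s t :: "3 \<Rightarrow> 3" and j :: 3
  defines "g \<equiv> plane_map (\<lambda>i. s (i + j)) (\<lambda>i. - s (i + j) * t (i + j)) (-j)"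
  assumes "s \<in> even_signs"
  shows "compose planes g (plane_map s t j) = (\<lambda>a\<in>planes. a)"
    and "compose planes (plane_map s t j) g = (\<lambda>a\<in>planes. a)"
proof -
  have sq: "s i * s i = 1" for i using assms by (simp add: even_signsD signs_square)
  have sq': "s i * (s i * x) = x" for x i using sq by (simp flip: mult.assoc)
  show "compose planes g (plane_map s t j) = (\<lambda>a\<in>planes. a)"
    and "compose planes (plane_map s t j) g = (\<lambda>a\<in>planes. a)"
    by (simp_all add: g_def plane_map_mult assms(2) even_signs_shift sq sq' plane_map_one)
qed

lemma plane_map_Bij:
  assumes "s \<in> even_signs"
  shows "plane_map s t j \<in> Bij planes"
proof -
  let ?g = "plane_map (\<lambda>i. s (i + j)) (\<lambda>i. - s (i + j) * t (i + j)) (-j)"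
  note inv = plane_map_inv[OF assms, where j = j and t = t]
  have g: "?g (plane_map s t j a) = a" "plane_map s t j (?g a) = a" if "a \<in> planes" for a
    using fun_cong[OF inv(1), of a] fun_cong[OF inv(2), of a] that by (simp_all add: compose_eq)
  have "bij_betw (plane_map s t j) planes planes"
  proof (rule bij_betw_byWitness[where f' = ?g])
    show "\<forall>a\<in>planes. ?g (plane_map s t j a) = a" "\<forall>a\<in>planes. plane_map s t j (?g a) = a"
      using g by blast+
  qed (auto simp: plane_map_in assms even_signs_shift)
  then show ?thesis by (simp add: Bij_def plane_map_def)
qed

lemma plane_groupI: "s \<in> even_signs \<Longrightarrow> plane_map s t j \<in> plane_group"
  by (auto simp: plane_group_def)

lemma subgroup_plane_group: "subgroup plane_group (BijGroup planes)"
proof (rule group.subgroupI[OF group_BijGroup])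
  show "plane_group \<subseteq> carrier (BijGroup planes)"
    by (auto simp: plane_group_def BijGroup_def plane_map_Bij)
  show "plane_group \<noteq> {}" using even_signs_one by (auto simp: plane_group_def)
next
  fix x assume "x \<in> plane_group"
  then obtain s t j where x: "s \<in> even_signs" "x = plane_map s t j" by (auto simp: plane_group_def)
  let ?g = "plane_map (\<lambda>i. s (i + j)) (\<lambda>i. - s (i + j) * t (i + j)) (-j)"
  have "inv\<^bsub>BijGroup planes\<^esub> x = ?g"
    by (rule group.inv_equality[OF group_BijGroup])
      (use x in \<open>simp_all add: BijGroup_def plane_map_Bij even_signs_shift plane_map_inv(1)[OF x(1), simplified]\<close>)
  then show "inv\<^bsub>BijGroup planes\<^esub> x \<in> plane_group"
    by (simp only: x plane_groupI even_signs_shift)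
next
  fix x y assume "x \<in> plane_group" "y \<in> plane_group"
  then obtain s t j s' t' j' where s: "s \<in> even_signs" "s' \<in> even_signs"
    and xy: "x = plane_map s t j" "y = plane_map s' t' j'"
    by (auto simp: plane_group_def)
  have "(\<lambda>i. s i * s' (i - j)) \<in> even_signs"
    using even_signs_mult[OF s(1) even_signs_shift[OF s(2), of "- j"]] by simp
  then show "x \<otimes>\<^bsub>BijGroup planes\<^esub> y \<in> plane_group"
    by (simp add: xy s BijGroup_def plane_map_Bij plane_map_mult plane_groupI)
qed

lemma transitive_plane_group:
  assumes "a \<in> planes" "b \<in> planes"
  shows "\<exists>x\<in>plane_group. x a = b"
proof -
  obtain i e c i' e' c' where ab: "a = (i, e, c)" "b = (i', e', c')" by (cases a, cases b)
  \<comment> \<open>The shift \<open>i' - i\<close> carries coordinate \<open>i\<close> to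
    \<open>i'\<close>. Only the values at \<open>i'\<close> and \<open>i' + 1\<close> affect the
    image of \<open>a\<close>: \<open>s\<close> turns \<open>e\<close> into
    \<open>e * e' * e = e'\<close>, and \<open>t\<close> corrects \<open>e * e' * c\<close> to
    \<open>c'\<close>. The value \<open>e * e'\<close> at both remaining coordinates makes the
    product of signs 1.\<close>
  define s where "s = (\<lambda>k. if k = i' then 1 else e * e')"
  define t where "t = (\<lambda>k. if k = i' then 0 else c' - e * e' * c)"
  have e: "e \<in> signs" "e' \<in> signs" using assms by (auto simp: ab planes_def)
  have ne: "k + 1 \<noteq> k" for k :: 3 by simp
  have "(\<Prod>k\<in>UNIV. s k) = (\<Prod>k\<in>UNIV - {i'}. s k)"
    by (subst prod.remove[of _ i']) (auto simp: s_def)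
  also have "\<dots> = (\<Prod>k\<in>UNIV - {i'}. e * e')" by (intro prod.cong) (auto simp: s_def)
  also have "\<dots> = e * e * (e' * e')" by (simp add: card_Diff_singleton power2_eq_square ac_simps)
  also have "\<dots> = 1" using e by (simp add: signs_square)
  finally have "s \<in> even_signs"
    using e by (auto simp: even_signs_def s_def signs_mult) (simp add: signs_def)
  moreover have "plane_map s t (i' - i) a = b"
    using assms e signs_square[OF e(1)]
    by (simp add: plane_map_def ab s_def t_def ne algebra_simps)
  ultimately show ?thesis by (auto simp: plane_group_def)
qed

section \<open>Fixed planes and the intersecting subgroup\<close>

text \<open>The number of signs -1 is 0 or 2. Two of them sit at cyclically adjacent indices, as any
  two indices modulo 3 do. Without any, two of the three translations agree in being zero or
  nonzero. The conclusion says that coordinates \<open>i\<close> and \<open>i + 1\<close> are both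
  trivial, both 3-cycles or both reflections.\<close>

lemma even_signs_pigeonhole:
  fixes t :: "3 \<Rightarrow> 3"
  assumes "s \<in> even_signs"
  shows "\<exists>i. s i = s (i + 1) \<and> (s i = 1 \<longrightarrow> (t i = 0 \<longleftrightarrow> t (i + 1) = 0))"
proof -
  have succ: "(0::3) + 1 = 1" "(1::3) + 1 = 2" "(2::3) + 1 = 0" by simp_all
  have ne: "(1::3) \<noteq> -1" "(-1::3) \<noteq> 1" by simp_all
  have "(\<Prod>i\<in>UNIV. s i) = s 0 * (s 1 * s 2)" by (subst UNIV_3) simp
  moreover have "(\<Prod>i\<in>UNIV. s i) = 1" using assms unfolding even_signs_def by blast
  ultimately have "s 0 * s 1 * s 2 = 1" by (simp only: mult.assoc)
  moreover have "s i = 1 \<or> s i = -1" for i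
    using even_signsD[OF assms, of i] by (simp add: signs_def)
  note this[of 0] this[of 1] this[of 2]
  ultimately have "(s 0 = 1 \<and> s 1 = 1 \<and> s 2 = 1) \<or> (s 0 = s 1 \<and> s 0 = -1) \<or>
      (s 1 = s 2 \<and> s 1 = -1) \<or> (s 2 = s 0 \<and> s 2 = -1)"
    using ne by (elim disjE) simp_all
  then have "(s 0 = s 1 \<and> (s 0 = 1 \<longrightarrow> (t 0 = 0 \<longleftrightarrow> t 1 = 0))) \<or>
      (s 1 = s 2 \<and> (s 1 = 1 \<longrightarrow> (t 1 = 0 \<longleftrightarrow> t 2 = 0))) \<or>
      (s 2 = s 0 \<and> (s 2 = 1 \<longrightarrow> (t 2 = 0 \<longleftrightarrow> t 0 = 0)))"
    using ne by (elim disjE conjE; cases "t 0 = 0"; cases "t 1 = 0"; cases "t 2 = 0") simp_all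
  then show ?thesis using succ by metis
qed

text \<open>For shift 0 and \<open>s i = s (i + 1)\<close> the plane \<open>(i, e, c)\<close> is
  fixed exactly when \<open>s i * c + t (i + 1) - e * t i = c\<close>; each conjugacy type admits a
  solution.\<close>

lemma plane_map_fixed_point:
  assumes s: "s \<in> even_signs"
  shows "\<exists>a\<in>planes. plane_map s t 0 a = a"
proof -
  obtain i where i: "s i = s (i + 1)" "s i = 1 \<longrightarrow> (t i = 0 \<longleftrightarrow> t (i + 1) = 0)"
    using even_signs_pigeonhole[OF s] by blast
  have "s i = 1 \<or> s i = -1" using even_signsD[OF s] by (auto simp: signs_def)
  then consider "s i = 1" "t i = 0" "t (i + 1) = 0" | "s i = 1" "t i \<noteq> 0" "t (i + 1) \<noteq> 0" | "s i = -1"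
    using i(2) by blast
  then show ?thesis
  proof cases
    case 1
    then show ?thesis using i(1)
      by (intro bexI[of _ "(i, 1, 0)"]) (auto simp: plane_map_def planes_def signs_def)
  next
    case 2
    \<comment> \<open>For \<open>s i = 1\<close> the equation reads
      \<open>t (i + 1) = e * t i\<close>, solved by this sign \<open>e\<close>.\<close>
    then have "t (i + 1) * t i \<in> signs" "t i * t i = 1"
      by (simp_all add: nonzero_signs signs_mult signs_square)
    then show ?thesis using i(1) 2
      by (intro bexI[of _ "(i, t (i + 1) * t i, 0)"]) (auto simp: plane_map_def planes_def mult.assoc)
  next
    case 3
    \<comment> \<open>For \<open>s i = -1\<close> and \<open>e = 1\<close> the equation is
      \<open>2 * c = t (i + 1) - t i\<close>, and 2 equals -1 modulo 3.\<close>
    define d where "d = t i - t (i + 1)"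
    have "(3 :: 3) = 0" by simp
    then have "3 * d = 0" by (metis mult_zero_left)
    moreover have "t i = d + t (i + 1)" by (simp add: d_def)
    then have "- d + t (i + 1) - t i = d - 3 * d" by (simp add: algebra_simps)
    ultimately have d: "- d + t (i + 1) - t i = d" by simp
    have "s (i + 1) = -1" using i(1) 3 by simp
    then have "plane_map s t 0 (i, 1, d) = (i, 1, d)"
      using 3 d by (simp add: plane_map_def planes_def signs_def)
    then show ?thesis
      by (intro bexI[of _ "(i, 1, d)"]) (auto simp: planes_def signs_def)
  qed
qed

text \<open>The elements agree wherever \<open>y\<close> inverse times \<open>x\<close> has a fixed
  point, and that quotient again has even signs and shift 0.\<close>

lemma intersecting_even_plane_group:
  assumes "x \<in> even_plane_group" "y \<in> even_plane_group"
  shows "\<exists>a\<in>planes. x a = y a"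
proof -
  obtain s t s' t' where xy: "s \<in> even_signs" "x = plane_map s t 0" "s' \<in> even_signs" "y = plane_map s' t' 0"
    using assms by (auto simp: even_plane_group_def)
  \<comment> \<open>The signs and translations of \<open>y\<close> inverse times \<open>x\<close>,
    using that \<open>s' i\<close> is its own inverse.\<close>
  define u v where "u = (\<lambda>i. s' i * s i)" and "v = (\<lambda>i. s' i * (t i - t' i))"
  have u: "u \<in> even_signs" unfolding u_def by (intro even_signs_mult xy)
  have sq: "s' i * s' i = 1" for i using xy by (simp add: even_signsD signs_square)
  have sq': "s' i * (s' i * x) = x" for x i using sq by (simp flip: mult.assoc)
  have x: "compose planes y (plane_map u v 0) = x"
    by (simp add: xy plane_map_mult u) (simp add: u_def v_def sq')
  obtain a where "a \<in> planes" "plane_map u v 0 a = a" using plane_map_fixed_point[OF u] by blast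
  then show ?thesis by (metis x compose_eq)
qed

text \<open>The three pure shifts \<open>?r j\<close> give cosets of the shift-free maps that cover
  the group.\<close>

lemma card_plane_group: "card plane_group \<le> 3 * card even_plane_group"
proof -
  have fin: "finite planes" by simp
  have "even_plane_group \<subseteq> Bij planes" by (auto simp: even_plane_group_def plane_map_Bij)
  then have fin': "finite even_plane_group" using finite_subset finite_Bij[OF fin] by blast
  let ?r = "\<lambda>j. plane_map (\<lambda>_. 1) (\<lambda>_. 0) j"
  have "plane_group \<subseteq> (\<Union>j\<in>UNIV. compose planes (?r j) ` even_plane_group)"
  proof
    fix x assume "x \<in> plane_group"
    then obtain s t j where x: "s \<in> even_signs" "x = plane_map s t j" by (auto simp: plane_group_def)
    \<comment> \<open>Shifting afterwards moves indices by \<open>-j\<close>, so the shift-free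
      factor carries the data at \<open>i + j\<close>.\<close>
    have "x = compose planes (?r j) (plane_map (\<lambda>i. s (i + j)) (\<lambda>i. t (i + j)) 0)"
      by (simp add: plane_map_mult even_signs_one even_signs_shift x)
    then show "x \<in> (\<Union>j\<in>UNIV. compose planes (?r j) ` even_plane_group)"
      using even_signs_shift[OF x(1), of j]
      by (intro UN_I[of j] image_eqI) (auto simp: even_plane_group_def)
  qed
  then have "card plane_group \<le> card (\<Union>j\<in>UNIV. compose planes (?r j) ` even_plane_group)"
    by (intro card_mono) (auto simp: fin')
  also have "\<dots> \<le> (\<Sum>j\<in>(UNIV :: 3 set). card (compose planes (?r j) ` even_plane_group))"
    by (rule card_UN_le) simp
  also have "\<dots> \<le> (\<Sum>j\<in>(UNIV :: 3 set). card even_plane_group)"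
    by (intro sum_mono card_image_le fin')
  finally show ?thesis by simp
qed

lemma card_planes: "card planes = 18"
  by (simp add: planes_def signs_def)

section \<open>The base group of degree 18 and its powers\<close>

lemma ex_transitive_group_rho_ge_6:
  obtains \<Delta> :: "nat set" and H where
    "finite_transitive_group \<Delta> H" "card \<Delta> = 18" "rho H \<Delta> \<ge> 6"
proof -
  let ?P = "perm_group planes plane_group"
  have "id \<in> hom ?P (BijGroup planes)"
    using subgroup.subset[OF subgroup_plane_group] by (simp add: hom_def subset_iff)
  then have hom: "group_hom ?P (BijGroup planes) id"
    using subgroup.subgroup_is_group[OF subgroup_plane_group group_BijGroup] group_BijGroup
    by (simp add: group_hom_def group_hom_axioms_def)
  interpret group_action ?P planes id by (rule group_action.intro[OF hom])
  have faith: "faithful_action ?P planes id" by unfold_locales simp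
  have trans: "transitive_action ?P planes id"
    by unfold_locales (use transitive_plane_group in auto)
  have base: "even_plane_group \<subseteq> carrier ?P"
    by (auto simp: even_plane_group_def plane_groupI)
  have int: "\<exists>a\<in>planes. id x a = id y a" if "x \<in> even_plane_group" "y \<in> even_plane_group" for x y
    using intersecting_even_plane_group[OF that] by simp
  have "finite planes" "planes \<noteq> {}" using card_planes by auto
  note ex = ex_perm_group_of_action[OF faith trans this base]
  obtain \<Delta> :: "nat set" and H where H: "finite_transitive_group \<Delta> H" "card \<Delta> = card planes"
    "perm_equivalent (perm_group \<Delta> H) \<Delta> id ?P planes id"
    "rho H \<Delta> \<ge> real (card even_plane_group) * real (card planes) / real (card (carrier ?P))"
    by (rule ex, erule (1) int)
  have "card plane_group > 0"
    using finite_subset[OF subgroup_BijGroup_subset[OF subgroup_plane_group] finite_Bij]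
      subgroup.one_closed[OF subgroup_plane_group] by (auto simp: card_gt_0_iff)
  \<comment> \<open>Index at most 3 gives the bound 18 / 3.\<close>
  then have "real (card even_plane_group) * real (card planes) / real (card (carrier ?P)) \<ge> 6"
    using card_plane_group by (simp add: card_planes field_simps)
  with H(4) have "rho H \<Delta> \<ge> 6" by linarith
  with H(1,2) show thesis using that card_planes by simp
qed

theorem theorem1p3:
  shows "infinite
    ({(\<Omega> :: nat set, G). finite_transitive_group \<Omega> G \<and> admits_product_decomposition \<Omega> G \<and>
        rho G \<Omega> > sqrt (real (card \<Omega>))} // perm_equiv_rel)"
    (is "infinite (?X // _)")
proof (rule infinite_quotient_perm_equiv_rel)
  show "subgroup G (BijGroup \<Omega>)" if "(\<Omega>, G) \<in> ?X" for \<Omega> :: "nat set" and G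
    using that by (simp add: finite_transitive_group_def)
  obtain \<Delta> :: "nat set" and H where H: "finite_transitive_group \<Delta> H" "card \<Delta> = 18" "rho H \<Delta> \<ge> 6"
    by (rule ex_transitive_group_rho_ge_6)
  \<comment> \<open>The offset 2 guarantees at least two factors, as a product decomposition
    requires.\<close>
  have "18 ^ (n + 2) \<in> (\<lambda>(\<Omega>, G). card \<Omega>) ` ?X" for n
  proof -
    have "2 \<le> card \<Delta>" "2 \<le> n + 2" using H by simp_all
    then obtain \<Omega> :: "nat set" and G where G: "finite_transitive_group \<Omega> G"
      "admits_product_decomposition \<Omega> G" "card \<Omega> = 18 ^ (n + 2)" "rho G \<Omega> \<ge> rho H \<Delta> ^ (n + 2)"
      using admits_product_decomposition_power[OF H(1)] H(2) by metis
    have "sqrt (real (card \<Omega>)) = sqrt 18 ^ (n + 2)"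
      by (simp only: G(3) of_nat_power of_nat_numeral real_sqrt_power)
    \<comment> \<open>Here 18 < 36 = 6 * 6.\<close>
    also have "\<dots> < 6 ^ (n + 2)"
      by (intro power_strict_mono real_less_lsqrt) simp_all
    also have "\<dots> \<le> rho H \<Delta> ^ (n + 2)" using H(3) by (intro power_mono) simp_all
    also have "\<dots> \<le> rho G \<Omega>" by (rule G(4))
    finally have "(\<Omega>, G) \<in> ?X" using G by simp
    then show ?thesis using G(3) by (intro image_eqI[of _ _ "(\<Omega>, G)"]) simp_all
  qed
  then have "range (\<lambda>n. 18 ^ (n + 2)) \<subseteq> (\<lambda>(\<Omega>, G). card \<Omega>) ` ?X" by blast
  moreover have "infinite (range (\<lambda>n. 18 ^ (n + 2) :: nat))"
    by (simp add: finite_image_iff inj_on_def)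
  ultimately show "infinite ((\<lambda>(\<Omega>, G). card \<Omega>) ` ?X)" by (rule infinite_super)
qed

end
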